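(* Let $X=[\ell,u]\subseteq\mathbb{R}^n$ be a box with $\ell_i<u_i$ for all $i$, and assume $g:\mathbb{R}^n\to\mathbb{R}$ is a closed proper convex function. For any $\epsilon>0$, Algorithm 2 (defined in the context) terminates after a finite number of iterations.
   Context: $X=\{x\in\mathbb{R}^n\mid \ell_i\le x_i\le u_i,\ i=1,\dots,n\}$ with $\ell_i<u_i$ for all $i$. For $x\in\mathbb{R}^n$, $c(x)$ denotes an (arbitrary, chosen) element of the subdifferential $\partial g(x)$, and for $x^*\in\mathbb{R}^n$, $$H(g,x^* )=\{(x,t)\in\mathbb{R}^n\times\mathbb{R}\mid t-c(x^* )^{\mathsf T}x\ge g(x^* )-c(x^* )^{\mathsf T}x^*\}.$$ $\operatorname{vert} C$ denotes the set of vertices of a polyhedral convex set $C$. Algorithm 2 (input $g$, $X=[\ell,u]$, $\epsilon$): Set $\mathcal V=\emptyset$, $k=0$, $R=\emptyset$, $x^0=\frac{\ell+u}{2}$, $C^0=H(g,x^0)\cap(X\times\mathbb{R})$, $g^0(x)=g(x^0)+c(x^0)^{\mathsf T}(x-x^0)$. While $R\ne\mathbb{R}^{n+1}$, do (one iteration): compute $\operatorname{vert}C^k$; set $R=\mathbb{R}^{n+1}$, $j=0$, $g^{k,0}=g^k$; for every $(\bar x,\bar y)\in\operatorname{vert}C^k\setminus\mathcal V$: if $g(\bar x)-\bar y>\epsilon$, replace $R$ by $R\cap H(g,\bar x)$, set $g^{k,j+1}(x)=\max\{g^{k,j}(x),\,g(\bar x)+c(\bar x)^{\mathsf T}(x-\bar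 x)\}$ and increase $j$ by $1$; otherwise add $(\bar x,\bar y)$ to $\mathcal V$. After all these vertices have been treated, set $C^{k+1}=C^k\cap R$, $g^{k+1}=g^{k,j}$, and increase $k$ by $1$. When the while loop ends (i.e. a pass finished with $R=\mathbb{R}^{n+1}$), return $g^k$ (and $\operatorname{vert}C^k$). *)

theory Defs
  imports "HOL-Analysis.Analysis"
begin

definition subdifferential :: "('a::real_inner \<Rightarrow> real) \<Rightarrow> 'a \<Rightarrow> 'a set" where
  "subdifferential g x = {s. \<forall>y. g y \<ge> g x + s \<bullet> (y - x)}"

definition vert :: "'a::real_vector set \<Rightarrow> 'a set" where
  "vert C = {v. v extreme_point_of C}"

text \<open>Throughout, \<open>c\<close> is the chosen selection of subgradients of \<open>g\<close>.\<close>

definition H :: "('a::real_inner \<Rightarrow> real) \<Rightarrow> ('a \<Rightarrow> 'a) \<Rightarrow> 'a \<Rightarrow> ('a \<times> real) set" where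
  "H g c z = {(x, t). t - c z \<bullet> x \<ge> g z - c z \<bullet> z}"

definition affine_minorant :: "('a::real_inner \<Rightarrow> real) \<Rightarrow> ('a \<Rightarrow> 'a) \<Rightarrow> 'a \<Rightarrow> 'a \<Rightarrow> real" where
  "affine_minorant g c z x = g z + c z \<bullet> (x - z)"

text \<open>
  The program variables of the cutting-plane algorithm.  Between iterations \<open>approx\<close> holds
  \<open>g\<^sup>k\<close>; inside the inner loop it holds \<open>g\<^sup>k\<^sup>,\<^sup>j\<close>.
\<close>

record 'a alg_state =
  iter :: nat
  cuts :: nat
  poly_set :: "('a \<times> real) set"
  treated :: "('a \<times> real) set"
  region :: "('a \<times> real) set"
  approx :: "'a \<Rightarrow> real"

definition init_state ::
  "('a::euclidean_space \<Rightarrow> real) \<Rightarrow> ('a \<Rightarrow> 'a) \<Rightarrow> 'a \<Rightarrow> 'a \<Rightarrow> 'a alg_state" where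
  "init_state g c l u =
     (let x0 = (1 / 2) *\<^sub>R (l + u) in
      \<lparr>iter = 0, cuts = 0, poly_set = H g c x0 \<inter> (cbox l u \<times> UNIV), treated = {},
       region = {}, approx = affine_minorant g c x0\<rparr>)"

definition process_vertex ::
  "('a::real_inner \<Rightarrow> real) \<Rightarrow> ('a \<Rightarrow> 'a) \<Rightarrow> real \<Rightarrow> 'a \<times> real \<Rightarrow> 'a alg_state \<Rightarrow> 'a alg_state" where
  "process_vertex g c \<epsilon> v s =
     (let (x, y) = v in
      if g x - y > \<epsilon>
      then s\<lparr>region := region s \<inter> H g c x,
             approx := (\<lambda>z. max (approx s z) (affine_minorant g c x z)),
             cuts := cuts s + 1\<rparr>
      else s\<lparr>treated := insert v (treated s)\<rparr>)"

text \<open>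
  One pass of the while loop, including its guard.  The order in which the inner loop visits the
  vertices is left open, so this is a relation; it has no successor state if there are infinitely
  many vertices to visit.
\<close>

definition iteration ::
  "('a::real_inner \<Rightarrow> real) \<Rightarrow> ('a \<Rightarrow> 'a) \<Rightarrow> real \<Rightarrow> 'a alg_state \<Rightarrow> 'a alg_state \<Rightarrow> bool" where
  "iteration g c \<epsilon> s s' \<longleftrightarrow>
     region s \<noteq> UNIV \<and>
     (\<exists>vs t. distinct vs \<and> set vs = vert (poly_set s) - treated s \<and>
        t = fold (process_vertex g c \<epsilon>) vs (s\<lparr>region := UNIV, cuts := 0\<rparr>) \<and>
        s' = t\<lparr>poly_set := poly_set t \<inter> region t, iter := iter t + 1\<rparr>)"

text \<open>
  Termination of a nondeterministic while loop with body \<open>step\<close> and exit condition \<open>final\<close>: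
  execution never gets stuck before the exit condition holds, and no execution is infinite.
\<close>

definition terminates_from :: "('s \<Rightarrow> 's \<Rightarrow> bool) \<Rightarrow> ('s \<Rightarrow> bool) \<Rightarrow> 's \<Rightarrow> bool" where
  "terminates_from step final s0 \<longleftrightarrow>
     (\<forall>s. step\<^sup>*\<^sup>* s0 s \<and> \<not> final s \<longrightarrow> (\<exists>s'. step s s')) \<and>
     \<not> (\<exists>\<sigma> :: nat \<Rightarrow> 's. \<sigma> 0 = s0 \<and> (\<forall>m. step (\<sigma> m) (\<sigma> (Suc m))))"

end

theory Submission
  imports Defs
begin

text \<open>
  The loop cannot get stuck: every \<open>C\<^sup>k\<close> is cut out of the box by finitely many half-spaces, so it
  is a polyhedron and has finitely many vertices to visit.

  An infinite run is impossible because its cuts are made at uniformly separated points of the box.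
  Since no pass ends with \<open>R = UNIV\<close>, every pass \<open>m\<close> cuts at some vertex \<open>(x\<^sub>m, y\<^sub>m)\<close>
  of \<open>C\<^sup>m\<close> with \<open>g x\<^sub>m - y\<^sub>m > \<epsilon>\<close>, and the cut \<open>H g c x\<^sub>m\<close> contains every later
  \<open>C\<^sup>k\<close>.  So for \<open>m < k\<close> the value at \<open>x\<^sub>k\<close> of the affine minorant taken at \<open>x\<^sub>m\<close> is at
  most \<open>y\<^sub>k\<close>, hence lies more than \<open>\<epsilon>\<close> below \<open>g x\<^sub>k\<close>
  (\<open>later_vertex_below_cut\<close>).  But a convex function
  has bounded subgradients on a bounded set (\<open>bounded_subgradients\<close>), and if \<open>L\<close> is a
  bound on the box, then an affine minorant misses \<open>g\<close> by at most \<open>2 * L\<close> times the distance to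
  the point where it touches (\<open>affine_minorant_gap\<close>).  Therefore
  \<open>\<epsilon> < 2 * L * dist x\<^sub>m x\<^sub>k\<close> for all \<open>m < k\<close>, which the compactness of the box forbids.
\<close>

section \<open>Subgradients of a finite convex function\<close>

text \<open>
  A long subgradient \<open>s\<close> at \<open>x\<close> forces \<open>g\<close> to grow by \<open>norm s\<close> over the unit step in direction
  \<open>s\<close>, while the continuous function \<open>g\<close> is bounded on the closed unit neighbourhood of \<open>S\<close>.
\<close>

lemma bounded_subgradients:
  fixes g :: "'a::euclidean_space \<Rightarrow> real"
  assumes "convex_on UNIV g" and "bounded S"
  obtains L where "L > 0" and "\<And>x s. x \<in> S \<Longrightarrow> s \<in> subdifferential g x \<Longrightarrow> norm s \<le> L"
proof -
  obtain r where r: "\<And>x. x \<in> S \<Longrightarrow> norm x \<le> r"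
    using \<open>bounded S\<close> by (auto simp: bounded_iff)
  have "continuous_on (cball 0 (r + 1)) g"
    using convex_on_continuous[OF open_UNIV assms(1)] continuous_on_subset by blast
  then have "bounded (g ` cball 0 (r + 1))"
    by (intro compact_imp_bounded compact_continuous_image compact_cball)
  then obtain B where B: "B > 0" "\<And>x. norm x \<le> r + 1 \<Longrightarrow> \<bar>g x\<bar> \<le> B"
    by (auto simp: bounded_pos)
  have "norm s \<le> 2 * B" if "x \<in> S" and s: "s \<in> subdifferential g x" for x s
  proof -
    have "g x + s \<bullet> sgn s \<le> g (x + sgn s)"
      using s by (auto simp: subdifferential_def dest: spec[of _ "x + sgn s"])
    moreover have "s \<bullet> sgn s = norm s"
      by (cases "s = 0") (simp_all add: sgn_div_norm power2_norm_eq_inner[symmetric] power2_eq_square)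
    moreover have "norm (x + sgn s) \<le> r + 1"
      using norm_triangle_ineq[of x "sgn s"] r[OF \<open>x \<in> S\<close>] by (simp add: norm_sgn split: if_splits)
    ultimately show ?thesis
      using B(2)[of x] B(2)[of "x + sgn s"] r[OF \<open>x \<in> S\<close>] by linarith
  qed
  with \<open>B > 0\<close> show thesis
    by (intro that[of "2 * B"]) auto
qed

text \<open>
  The subgradient at \<open>x\<close> bounds the slope of \<open>g\<close> from \<open>z\<close> to \<open>x\<close> from above, and the minorant
  itself has slope \<open>c z\<close>; each contributes one \<open>L\<close>.
\<close>

lemma affine_minorant_gap:
  assumes "c x \<in> subdifferential g x" and "norm (c x) \<le> L" and "norm (c z) \<le> L"
  shows "g x - affine_minorant g c z x \<le> 2 * L * dist z x"
proof -
  have "g x + c x \<bullet> (z - x) \<le> g z"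
    using assms(1) by (auto simp: subdifferential_def)
  then have "g x - affine_minorant g c z x \<le> (c x - c z) \<bullet> (x - z)"
    by (simp add: affine_minorant_def inner_diff_left inner_diff_right)
  also have "\<dots> \<le> norm (c x - c z) * norm (x - z)"
    by (rule norm_cauchy_schwarz)
  also have "\<dots> \<le> (2 * L) * norm (x - z)"
    using norm_triangle_ineq4[of "c x" "c z"] assms(2,3) by (intro mult_right_mono) auto
  finally show ?thesis
    by (simp add: dist_norm norm_minus_commute)
qed

lemma compact_imp_close_terms:
  fixes x :: "nat \<Rightarrow> 'a::metric_space"
  assumes "compact S" and "\<And>n. x n \<in> S" and "e > 0"
  obtains m k where "m < k" and "dist (x m) (x k) < e"
proof -
  obtain r where "strict_mono r" and "Cauchy (x \<circ> r)"
    using assms(1,2) by (meson LIMSEQ_imp_Cauchy compact_def)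
  then obtain N where "dist (x (r N)) (x (r (Suc N))) < e"
    using metric_CauchyD[OF _ \<open>e > 0\<close>, of "x \<circ> r"] by (metis comp_apply le_refl le_SucI)
  with \<open>strict_mono r\<close> show thesis
    by (meson that strict_mono_Suc_iff)
qed

section \<open>One pass of the loop\<close>

lemma mem_H_iff: "(x, t) \<in> H g c z \<longleftrightarrow> affine_minorant g c z x \<le> t"
  by (auto simp: H_def affine_minorant_def inner_diff_right)

lemma polyhedron_H:
  fixes z :: "'a::euclidean_space"
  shows "polyhedron (H g c z)"
proof -
  have "H g c z = {p. (- c z, 1) \<bullet> p \<ge> g z - c z \<bullet> z}"
    by (auto simp: H_def)
  then show ?thesis
    by (simp add: polyhedron_halfspace_ge)
qed

lemma poly_set_process_vertex: "poly_set (process_vertex g c \<epsilon> v s) = poly_set s"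
  by (cases v) (simp add: process_vertex_def)

lemma region_process_vertex:
  "region (process_vertex g c \<epsilon> (x, y) s) = (if g x - y > \<epsilon> then region s \<inter> H g c x else region s)"
  by (simp add: process_vertex_def)

lemma poly_set_fold_process_vertex:
  "poly_set (fold (process_vertex g c \<epsilon>) vs s) = poly_set s"
  by (induction vs arbitrary: s) (simp_all add: poly_set_process_vertex)

lemma region_fold_process_vertex:
  "region (fold (process_vertex g c \<epsilon>) vs s) =
     region s \<inter> (\<Inter>(x, y)\<in>{(x, y) \<in> set vs. g x - y > \<epsilon>}. H g c x)"
proof (induction vs arbitrary: s)
  case (Cons v vs)
  obtain a b where "v = (a, b)"
    by (cases v)
  then show ?case
    by (auto simp: Cons.IH region_process_vertex)
qed simp

text \<open>
  The interface to a pass for the termination argument: the traversal of a list of vertices in an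
  unspecified order becomes a statement about the set of visited vertices.
\<close>

lemma iterationD:
  assumes "iteration g c \<epsilon> s s'"
  shows "finite (vert (poly_set s) - treated s)"
    and "region s' =
      (\<Inter>(x, y)\<in>{(x, y) \<in> vert (poly_set s) - treated s. g x - y > \<epsilon>}. H g c x)"
    and "poly_set s' = poly_set s \<inter> region s'"
proof -
  obtain vs where vs: "set vs = vert (poly_set s) - treated s"
    and s': "s' = (let t = fold (process_vertex g c \<epsilon>) vs (s\<lparr>region := UNIV, cuts := 0\<rparr>)
                   in t\<lparr>poly_set := poly_set t \<inter> region t, iter := iter t + 1\<rparr>)"
    using assms by (auto simp: iteration_def Let_def)
  show "finite (vert (poly_set s) - treated s)"
    by (metis vs List.finite_set)
  show "region s' =
      (\<Inter>(x, y)\<in>{(x, y) \<in> vert (poly_set s) - treated s. g x - y > \<epsilon>}. H g c x)"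
    by (simp add: s' Let_def region_fold_process_vertex vs)
  show "poly_set s' = poly_set s \<inter> region s'"
    by (simp add: s' Let_def poly_set_fold_process_vertex)
qed

lemma iteration_exists:
  assumes "region s \<noteq> UNIV" and "finite (vert (poly_set s))"
  shows "\<exists>s'. iteration g c \<epsilon> s s'"
proof -
  obtain vs where "distinct vs" "set vs = vert (poly_set s) - treated s"
    using finite_distinct_list[of "vert (poly_set s) - treated s"] assms(2) by auto
  with assms(1) show ?thesis
    unfolding iteration_def by blast
qed

lemma polyhedron_cbox_Times_UNIV:
  "polyhedron (cbox l u \<times> (UNIV :: 'b::euclidean_space set))"
proof -
  have "cbox l u \<times> (UNIV :: 'b set) =
      (\<Inter>i\<in>Basis. {p. (i, 0) \<bullet> p \<ge> l \<bullet> i}) \<inter> (\<Inter>i\<in>Basis. {p. (i, 0) \<bullet> p \<le> u \<bullet> i})"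
    by (auto simp: mem_box inner_commute)
  then show ?thesis
    by (auto intro!: polyhedron_Int polyhedron_Inter
        simp: polyhedron_halfspace_ge polyhedron_halfspace_le simp del: inner_Pair)
qed

lemma polyhedron_poly_set_init_state: "polyhedron (poly_set (init_state g c l u))"
  by (simp add: init_state_def Let_def polyhedron_H polyhedron_cbox_Times_UNIV)

lemma polyhedron_poly_set_step:
  fixes s :: "'a::euclidean_space alg_state"
  assumes step: "iteration g c \<epsilon> s s'" and "polyhedron (poly_set s)"
  shows "polyhedron (poly_set s')"
proof -
  have "finite {(x, y) \<in> vert (poly_set s) - treated s. g x - y > \<epsilon>}"
    using iterationD(1)[OF step] by (rule rev_finite_subset) auto
  then have "polyhedron (region s')"
    unfolding iterationD(2)[OF step] by (intro polyhedron_Inter) (auto simp: polyhedron_H)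
  with assms(2) show ?thesis
    by (simp add: iterationD(3)[OF step])
qed

lemma polyhedron_poly_set:
  assumes "(iteration g c \<epsilon>)\<^sup>*\<^sup>* (init_state g c l u) s"
  shows "polyhedron (poly_set s)"
  using assms
  by induction (auto intro: polyhedron_poly_set_init_state polyhedron_poly_set_step)

section \<open>Infinite runs\<close>

lemma infinite_run_cuts:
  assumes run: "\<And>m. iteration g c \<epsilon> (\<sigma> m) (\<sigma> (Suc m))"
  obtains x y where "\<And>m. (x m, y m) \<in> poly_set (\<sigma> m)" and "\<And>m. g (x m) - y m > \<epsilon>"
    and "\<And>m. poly_set (\<sigma> (Suc m)) \<subseteq> H g c (x m)"
proof -
  have "\<exists>x y. (x, y) \<in> poly_set (\<sigma> m) \<and> g x - y > \<epsilon> \<and> poly_set (\<sigma> (Suc m)) \<subseteq> H g c x" for m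
  proof -
    note D = iterationD[OF run[of m]]
    \<comment> \<open>the guard of the following pass: some cut was made in this one\<close>
    have "region (\<sigma> (Suc m)) \<noteq> UNIV"
      using run[of "Suc m"] by (simp add: iteration_def)
    then obtain x y where v: "(x, y) \<in> vert (poly_set (\<sigma> m)) - treated (\<sigma> m)" "g x - y > \<epsilon>"
      unfolding D(2) by fast
    then have "(x, y) \<in> poly_set (\<sigma> m)"
      by (auto simp: vert_def extreme_point_of_def)
    moreover have "poly_set (\<sigma> (Suc m)) \<subseteq> H g c x"
      using v unfolding D(3) unfolding D(2) by blast
    ultimately show ?thesis
      using v by blast
  qed
  then show thesis
    using that by metis
qed

lemma poly_set_antimono:
  assumes "\<And>m. iteration g c \<epsilon> (\<sigma> m) (\<sigma> (Suc m))" and "m \<le> k"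
  shows "poly_set (\<sigma> k) \<subseteq> poly_set (\<sigma> m)"
  using \<open>m \<le> k\<close>
proof (induction rule: dec_induct)
  case (step n)
  with iterationD(3)[OF assms(1)[of n]] show ?case
    by blast
qed simp

text \<open>
  The point \<open>(x k, y k)\<close> survives the cut made at \<open>x m\<close> and lies more than \<open>\<epsilon>\<close> below the
  graph of \<open>g\<close>, so the minorant taken at \<open>x m\<close> is still a bad approximation at \<open>x k\<close>.
\<close>

lemma later_vertex_below_cut:
  assumes run: "\<And>m. iteration g c \<epsilon> (\<sigma> m) (\<sigma> (Suc m))"
    and mem: "\<And>m. (x m, y m) \<in> poly_set (\<sigma> m)" and gap: "\<And>m. g (x m) - y m > \<epsilon>"
    and cut: "\<And>m. poly_set (\<sigma> (Suc m)) \<subseteq> H g c (x m)"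
    and "m < k"
  shows "g (x k) - affine_minorant g c (x m) (x k) > \<epsilon>"
proof -
  have "(x k, y k) \<in> H g c (x m)"
    using poly_set_antimono[of g c \<epsilon> \<sigma> "Suc m" k, OF run] \<open>m < k\<close> mem[of k] cut[of m] by auto
  with gap[of k] show ?thesis
    by (simp add: mem_H_iff)
qed

lemma no_infinite_run:
  fixes g :: "'a::euclidean_space \<Rightarrow> real"
  assumes convex: "convex_on UNIV g"
    and subgradient: "\<And>x. c x \<in> subdifferential g x"
    and eps: "\<epsilon> > 0"
    and init: "poly_set (\<sigma> 0) \<subseteq> K \<times> UNIV" and "compact K"
    and run: "\<And>m. iteration g c \<epsilon> (\<sigma> m) (\<sigma> (Suc m))"
  shows False
proof -
  obtain x y where mem: "\<And>m. (x m, y m) \<in> poly_set (\<sigma> m)" and gap: "\<And>m. g (x m) - y m > \<epsilon>"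
    and cut: "\<And>m. poly_set (\<sigma> (Suc m)) \<subseteq> H g c (x m)"
    using infinite_run_cuts[of g c \<epsilon> \<sigma>, OF run] by blast
  have x: "x m \<in> K" for m
    using mem[of m] init poly_set_antimono[of g c \<epsilon> \<sigma> 0 m, OF run] by auto
  obtain L where "L > 0" and L: "\<And>z s. z \<in> K \<Longrightarrow> s \<in> subdifferential g z \<Longrightarrow> norm s \<le> L"
    using bounded_subgradients[OF convex compact_imp_bounded[OF \<open>compact K\<close>]] by blast
  \<comment> \<open>two cut points closer to each other than the separation forced by the gap \<open>\<epsilon>\<close>\<close>
  obtain m k where "m < k" and close: "dist (x m) (x k) < \<epsilon> / (2 * L)"
    using compact_imp_close_terms[of K x "\<epsilon> / (2 * L)"] \<open>compact K\<close> x eps \<open>L > 0\<close> by auto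
  have "\<epsilon> < g (x k) - affine_minorant g c (x m) (x k)"
    using later_vertex_below_cut[of g c \<epsilon> \<sigma> x y, OF run mem gap cut \<open>m < k\<close>] .
  also have "\<dots> \<le> 2 * L * dist (x m) (x k)"
    by (intro affine_minorant_gap subgradient L[OF x subgradient])
  also have "\<dots> < \<epsilon>"
    using close \<open>L > 0\<close> by (simp add: field_simps)
  finally show False .
qed

theorem theorem3p14:
  fixes l u :: "real ^ 'n" and g :: "real ^ 'n \<Rightarrow> real" and c :: "real ^ 'n \<Rightarrow> real ^ 'n"
    and \<epsilon> :: real
  assumes box: "\<And>i. l $ i < u $ i"
    and convex: "convex_on UNIV g"
    and closed: "closed (epigraph UNIV g)"
    and subgradient: "\<And>x. c x \<in> subdifferential g x"
    and eps: "\<epsilon> > 0"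
  shows "terminates_from (iteration g c \<epsilon>) (\<lambda>s. region s = UNIV) (init_state g c l u)"
  unfolding terminates_from_def
proof (intro conjI allI impI notI)
  fix s
  assume s: "(iteration g c \<epsilon>)\<^sup>*\<^sup>* (init_state g c l u) s \<and> region s \<noteq> UNIV"
  then have "finite (vert (poly_set s))"
    unfolding vert_def by (metis finite_polyhedron_extreme_points polyhedron_poly_set)
  with s show "\<exists>s'. iteration g c \<epsilon> s s'"
    by (intro iteration_exists) simp
next
  assume "\<exists>\<sigma>. \<sigma> 0 = init_state g c l u \<and> (\<forall>m. iteration g c \<epsilon> (\<sigma> m) (\<sigma> (Suc m)))"
  then obtain \<sigma> where "\<sigma> 0 = init_state g c l u" and run: "\<And>m. iteration g c \<epsilon> (\<sigma> m) (\<sigma> (Suc m))"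
    by blast
  then have "poly_set (\<sigma> 0) \<subseteq> cbox l u \<times> UNIV"
    by (auto simp: init_state_def Let_def)
  then show False
    using no_infinite_run[of g c \<epsilon> \<sigma> "cbox l u", OF convex subgradient eps _ compact_cbox run] by blast
qed

end
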